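(* Let $K\subseteq\mathbb{R}^n$ be a bounded measurable set. Then there is a covering of $\mathbb{R}^n$ by translated copies of $K$ of density at most $$\inf_{\delta}\left[\frac{\operatorname{vol}(K)}{\operatorname{vol}(K_{-\delta})}\left(1+\ln\frac{\operatorname{vol}\left(K_{-\delta/2}\right)}{\operatorname{vol}\left(\mathbf{B}\left(o,\frac{\delta}{2}\right)\right)}\right)\right],$$ where the infimum is taken over all $\delta>0$ with $\operatorname{vol}(K_{-\delta})>0$ (and is $+\infty$, so that nothing is claimed, if there is no such $\delta$).
   Context: $\operatorname{vol}$ is Lebesgue measure on $\mathbb{R}^n$, $\mathbf{B}(x,\delta)$ is the Euclidean ball of radius $\delta$ centered at $x$, and $o$ is the origin. For $K\subseteq\mathbb{R}^n$ and $\delta>0$, the $\delta$-inner parallel body of $K$ is $K_{-\delta}=\{x\in K : \mathbf{B}(x,\delta)\subseteq K\}$. A covering of $\mathbb{R}^n$ by translated copies of $K$ is a family $\{K+x_i\}_{i\in I}$ with $\bigcup_{i\in I}(K+x_i)=\mathbb{R}^n$. Its density is the (upper) density $$\limsup_{a\to\infty}\frac{1}{\operatorname{vol}([-a,a]^n)}\sum_{i\,:\,(K+x_i)\cap[-a,a]^n\neq\emptyset}\operatorname{vol}(K+x_i).$$ *)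

theory Defs
  imports "HOL-Analysis.Analysis"
begin

text \<open>Lebesgue measure on \<open>\<real>\<^sup>n\<close> is the completed measure \<^term>\<open>lebesgue\<close>, and balls are closed.\<close>

definition inner_parallel_body :: "real \<Rightarrow> (real ^ 'n) set \<Rightarrow> (real ^ 'n) set" where
  "inner_parallel_body \<delta> K = {x \<in> K. cball x \<delta> \<subseteq> K}"

definition translated_copy :: "(real ^ 'n) set \<Rightarrow> real ^ 'n \<Rightarrow> (real ^ 'n) set" where
  "translated_copy K v = (\<lambda>y. y + v) ` K"

definition is_translative_covering ::
  "(real ^ 'n) set \<Rightarrow> 'i set \<Rightarrow> ('i \<Rightarrow> real ^ 'n) \<Rightarrow> bool" where
  "is_translative_covering K I x \<longleftrightarrow> (\<Union>i\<in>I. translated_copy K (x i)) = UNIV"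

definition centred_cube :: "real \<Rightarrow> (real ^ 'n) set" where
  "centred_cube a = cbox (\<chi> i. - a) (\<chi> i. a)"

text \<open>The sum is taken in \<^typ>\<open>ennreal\<close>, where it always exists, so that a family with infinitely
  many members (counted with multiplicity) meeting a cube gets the value \<open>\<infinity>\<close>
  if \<open>K\<close> has positive volume.\<close>

definition covering_density ::
  "(real ^ 'n) set \<Rightarrow> 'i set \<Rightarrow> ('i \<Rightarrow> real ^ 'n) \<Rightarrow> ennreal" where
  "covering_density K I x =
     Limsup at_top (\<lambda>a::real.
       (\<Sum>\<^sub>\<infinity>i\<in>{i \<in> I. translated_copy K (x i) \<inter> centred_cube a \<noteq> {}}.
          emeasure lebesgue (translated_copy K (x i)))
       / emeasure lebesgue (centred_cube a :: (real ^ 'n) set))"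

end

theory Submission
  imports Defs
begin

text \<open>
  The covering is periodic. Fix a torus \<open>\<real>\<^sup>n / L \<int>\<^sup>n\<close> so large that \<open>K\<close> embeds into it; a covering of
  the torus by \<open>N\<close> translates of \<open>K\<close> lifts to a covering of space of density \<open>N vol(K) / L\<^sup>n\<close>, so
  the task is to find one with few translates.

  For fixed \<open>\<delta>\<close>, replace the torus by a finite set of points, a maximal one with distances
  larger than \<open>\<delta>\<close>. By maximality every point of the torus is within \<open>\<delta>\<close> of the set, so it is enough
  to cover this finite set by translates of the inner parallel body \<open>K\<^sub>-\<^sub>\<delta>\<close>. The uniform distribution
  on all translations is a fractional cover of total mass \<open>L\<^sup>n / vol(K\<^sub>-\<^sub>\<delta>)\<close>. A translate of \<open>K\<^sub>-\<^sub>\<delta>\<close>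
  contains at most \<open>vol(K\<^sub>-\<^sub>\<delta>\<^sub>/\<^sub>2) / vol(B(o, \<delta>/2))\<close> of the points, because the balls of radius
  \<open>\<delta>/2\<close> around them are disjoint and lie in a translate of \<open>K\<^sub>-\<^sub>\<delta>\<^sub>/\<^sub>2\<close>; let \<open>d\<close> be the integer part of this
  quotient. The greedy algorithm turns the fractional cover into an
  integral one at the price of a factor \<open>1 + 1/2 + ... + 1/d \<le> 1 + ln d\<close>
  (\<open>greedy_cover\<close>), and this is the bound for \<open>\<delta>\<close> (\<open>torus_covering_exists\<close>).

  The infimum over \<open>\<delta>\<close> need not be handled by a limit. The torus does not depend on
  \<open>\<delta>\<close>, and a covering of it with the smallest possible number of translates satisfies the bounds
  for all \<open>\<delta>\<close> simultaneously.

  The volume of \<open>K\<^sub>-\<^sub>\<delta>\<^sub>/\<^sub>2\<close> is only meaningful if this set is measurable; that is a consequence of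
  Vitali's covering theorem (\<open>union_of_equal_cballs_measurable\<close>).
\<close>

section \<open>Inner parallel bodies and packings\<close>

text \<open>An uncountable union of closed balls need not be Borel. But every point of this union lies in
  arbitrarily small closed balls contained in the union (shrink a big ball towards the point), so
  by Vitali's theorem countably many of those small balls exhaust the union up to a null set.\<close>

lemma union_of_equal_cballs_measurable:
  fixes A :: "'a::euclidean_space set"
  assumes "0 < r"
  shows "(\<Union>y\<in>A. cball y r) \<in> sets lebesgue"
proof -
  let ?U = "\<Union>y\<in>A. cball y r"
  let ?K = "{(c, s). 0 < s \<and> cball c s \<subseteq> ?U}"
  have pos: "0 < snd i" if "i \<in> ?K" for i
    using that by auto
  have fine: "\<exists>i. i \<in> ?K \<and> x \<in> cball (fst i) (snd i) \<and> snd i < d" if x: "x \<in> ?U" and "0 < d" for x d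
  proof -
    obtain y where y: "y \<in> A" "dist y x \<le> r"
      using x by auto
    \<comment> \<open>Shrink \<open>cball y r\<close> towards its point \<open>x\<close>, by the factor \<open>t\<close>.\<close>
    define t where "t = min 1 (d / (2 * r))"
    have t: "0 < t" "t \<le> 1" "t * r < d"
      using \<open>0 < d\<close> \<open>0 < r\<close> by (auto simp: t_def min_def field_simps)
    define c where "c = x + t *\<^sub>R (y - x)"
    have dcx: "dist c x = t * dist y x"
      using t by (simp add: c_def dist_norm)
    have "y - c = (1 - t) *\<^sub>R (y - x)"
      by (simp add: c_def algebra_simps)
    then have dyc: "dist y c = (1 - t) * dist y x"
      using t by (simp add: dist_norm)
    have "cball c (t * r) \<subseteq> cball y r"
    proof
      fix z assume z: "z \<in> cball c (t * r)"
      have "dist y z \<le> dist y c + dist c z"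
        by (rule dist_triangle)
      also have "\<dots> \<le> (1 - t) * r + t * r"
        using z y t dyc by (intro add_mono) (auto intro: mult_left_mono)
      finally show "z \<in> cball y r"
        by (simp add: algebra_simps)
    qed
    moreover have "x \<in> cball c (t * r)"
      using dcx y t by (auto intro: mult_left_mono)
    ultimately have "(c, t * r) \<in> ?K \<and> x \<in> cball (fst (c, t * r)) (snd (c, t * r)) \<and> snd (c, t * r) < d"
      using y t \<open>0 < r\<close> by auto
    then show ?thesis
      by blast
  qed
  obtain C where C: "countable C" "C \<subseteq> ?K" "negligible (?U - (\<Union>i\<in>C. cball (fst i) (snd i)))"
    by (rule Vitali_covering_theorem_cballs[of ?K snd ?U fst, OF pos fine])
  have balls: "(\<Union>i\<in>C. cball (fst i) (snd i)) \<in> sets lebesgue"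
    using C(1) by (intro sets.countable_UN'') auto
  have rest: "?U - (\<Union>i\<in>C. cball (fst i) (snd i)) \<in> sets lebesgue"
    using C(3) by (simp add: negligible_imp_sets)
  have split: "?U = (\<Union>i\<in>C. cball (fst i) (snd i)) \<union> (?U - (\<Union>i\<in>C. cball (fst i) (snd i)))"
    using C(2) by fastforce
  show ?thesis
    by (subst split) (rule sets.Un[OF balls rest])
qed

lemma inner_parallel_body_measurable:
  fixes K :: "(real ^ 'n) set"
  assumes "0 < \<delta>"
  shows "inner_parallel_body \<delta> K \<in> sets lebesgue"
proof -
  have "inner_parallel_body \<delta> K = - (\<Union>y\<in>-K. cball y \<delta>)"
  proof (rule set_eqI)
    fix x :: "real ^ 'n"
    have "x \<in> cball x \<delta>"
      using assms by simp
    then have "x \<in> inner_parallel_body \<delta> K \<longleftrightarrow> cball x \<delta> \<subseteq> K"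
      unfolding inner_parallel_body_def by blast
    also have "\<dots> \<longleftrightarrow> x \<in> - (\<Union>y\<in>-K. cball y \<delta>)"
      by (auto simp: subset_eq dist_commute)
    finally show "x \<in> inner_parallel_body \<delta> K \<longleftrightarrow> x \<in> - (\<Union>y\<in>-K. cball y \<delta>)" .
  qed
  then show ?thesis
    using union_of_equal_cballs_measurable[OF assms, of "-K"] Compl_in_sets_lebesgue by metis
qed

lemma inner_parallel_body_subset: "inner_parallel_body \<delta> K \<subseteq> K"
  by (auto simp: inner_parallel_body_def)

lemma inner_parallel_body_lmeasurable:
  fixes K :: "(real ^ 'n) set"
  assumes "0 < \<delta>" "bounded K"
  shows "inner_parallel_body \<delta> K \<in> lmeasurable"
  using bounded_set_imp_lmeasurable[OF bounded_subset[OF assms(2) inner_parallel_body_subset]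
      inner_parallel_body_measurable[OF assms(1)]] .

text \<open>This inclusion is where the two radii in the bound meet: the points to be covered that lie in one
  translate of \<^term>\<open>inner_parallel_body \<delta> K\<close> carry disjoint balls of radius \<open>\<delta> / 2\<close>, all of
  which fit into the same translate of \<^term>\<open>inner_parallel_body (\<delta> / 2) K\<close>.\<close>

lemma cball_half_subset_inner_parallel_body:
  assumes "x \<in> inner_parallel_body \<delta> K" "0 \<le> \<delta>"
  shows "cball x (\<delta> / 2) \<subseteq> inner_parallel_body (\<delta> / 2) K"
proof
  fix z assume z: "z \<in> cball x (\<delta> / 2)"
  have "cball z (\<delta> / 2) \<subseteq> cball x \<delta>"
  proof
    fix w assume "w \<in> cball z (\<delta> / 2)"
    then show "w \<in> cball x \<delta>"
      using z dist_triangle[of x w z] by simp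
  qed
  then have "cball z (\<delta> / 2) \<subseteq> K"
    using assms by (auto simp: inner_parallel_body_def)
  then show "z \<in> inner_parallel_body (\<delta> / 2) K"
    using \<open>0 \<le> \<delta>\<close> by (auto simp: inner_parallel_body_def)
qed

lemma card_disjoint_translates_le:
  fixes B W :: "'a::euclidean_space set"
  assumes "B \<in> lmeasurable" "W \<in> lmeasurable" "finite S"
    and disj: "\<And>p q. p \<in> S \<Longrightarrow> q \<in> S \<Longrightarrow> p \<noteq> q \<Longrightarrow> disjnt ((+) p ` B) ((+) q ` B)"
    and sub: "\<And>p. p \<in> S \<Longrightarrow> (+) p ` B \<subseteq> W"
  shows "card S * measure lebesgue B \<le> measure lebesgue W"
proof -
  have "card S * measure lebesgue B = (\<Sum>p\<in>S. measure lebesgue ((+) p ` B))"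
    by (simp add: measure_translation)
  also have "\<dots> = measure lebesgue (\<Union>p\<in>S. (+) p ` B)"
    using assms by (intro measure_UNION'[symmetric]) (auto simp: pairwise_def measurable_translation)
  also have "\<dots> \<le> measure lebesgue W"
    using assms(1-3) sub
    by (intro measure_mono_fmeasurable sets.finite_UN UN_least)
      (blast intro: measurable_translation fmeasurableD)+
  finally show ?thesis .
qed

section \<open>Greedy covers\<close>

text \<open>The difference between the harmonic number and the logarithm decreases from its value \<open>1\<close>
  at \<open>n = 1\<close>.\<close>

lemma harm_le_one_plus_ln:
  assumes "1 \<le> n"
  shows "harm n \<le> 1 + ln (real n)"
proof -
  obtain m where n: "n = Suc m"
    using assms by (cases n) auto
  have "harm (Suc m) - ln (real (Suc m)) \<le> harm (Suc 0) - ln (real (Suc 0))"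
    using decseq_harm_diff_ln unfolding decseq_def by blast
  then show ?thesis
    by (simp add: n harm_expand)
qed

text \<open>The greedy algorithm of Lovasz, with the sets to choose from indexed by \<^term>\<open>y \<in> F\<close>: the set of
  \<open>y\<close> consists of the points \<open>p\<close> with \<^term>\<open>y \<in> T p\<close>. The invariant handles all stages at once.
  While some set still contains \<open>k\<close> uncovered points, choosing it costs one and lowers the term
  \<^term>\<open>card U / k\<close> by one. Once all sets contain at most \<open>k - 1\<close> of them, the assumption on uncovered
  sets leaves at most \<open>(k - 1) t\<close> points, so replacing \<open>k\<close> by \<open>k - 1\<close> in the first term costs at most
  \<open>t / k\<close>, which is exactly the decrease of \<^term>\<open>t * harm k\<close>.\<close>

lemma greedy_cover_step_bound:
  fixes T :: "'p \<Rightarrow> 'a set" and t :: real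
  assumes "finite P" "0 \<le> t"
    and few: "\<And>U k. U \<subseteq> P \<Longrightarrow> \<forall>y\<in>F. card {p \<in> U. y \<in> T p} \<le> k \<Longrightarrow> card U \<le> k * t"
    and "U \<subseteq> P" "1 \<le> k" "\<forall>y\<in>F. card {p \<in> U. y \<in> T p} \<le> k"
  shows "\<exists>C\<subseteq>F. finite C \<and> (\<forall>p\<in>U. C \<inter> T p \<noteq> {}) \<and> card C \<le> card U / k + t * (harm k - 1)"
  using assms(4-6)
proof (induction "k + card U" arbitrary: U k rule: less_induct)
  case less
  have finU: "finite U"
    using less.prems \<open>finite P\<close> finite_subset by blast
  have harm1: "1 \<le> (harm k :: real)"
    using harm_mono[of 1 k, where 'a = real] less.prems by (simp add: harm_expand)
  consider (empty) "U = {}"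
    | (full) y where "y \<in> F" "card {p \<in> U. y \<in> T p} = k"
    | (sparse) "U \<noteq> {}" "\<forall>y\<in>F. card {p \<in> U. y \<in> T p} \<le> k - 1"
  proof (cases "\<exists>y\<in>F. card {p \<in> U. y \<in> T p} = k")
    case False
    have "card {p \<in> U. y \<in> T p} \<le> k - 1" if "y \<in> F" for y
    proof -
      have "card {p \<in> U. y \<in> T p} \<le> k" "card {p \<in> U. y \<in> T p} \<noteq> k"
        using less.prems(3) False that by auto
      then show ?thesis
        by linarith
    qed
    then show thesis
      using that by blast
  qed (use that in blast)
  then show ?case
  proof cases
    case empty
    then show ?thesis
      using harm1 \<open>0 \<le> t\<close> by (intro exI[of _ "{}"]) auto
  next
    case full
    define V where "V = {p \<in> U. y \<notin> T p}"
    have "U = V \<union> {p \<in> U. y \<in> T p}"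
      by (auto simp: V_def)
    then have cU: "card U = card V + k"
      using card_Un_disjoint[of V "{p \<in> U. y \<in> T p}"] finU full by (auto simp: V_def)
    have sp: "\<forall>y\<in>F. card {p \<in> V. y \<in> T p} \<le> k"
    proof
      fix z assume "z \<in> F"
      have "card {p \<in> V. z \<in> T p} \<le> card {p \<in> U. z \<in> T p}"
        using finU by (intro card_mono) (auto simp: V_def)
      then show "card {p \<in> V. z \<in> T p} \<le> k"
        using less.prems \<open>z \<in> F\<close> by (meson order_trans)
    qed
    have "V \<subseteq> P"
      using less.prems by (auto simp: V_def)
    then obtain C where C: "C \<subseteq> F" "finite C" "\<forall>p\<in>V. C \<inter> T p \<noteq> {}"
        "card C \<le> card V / k + t * (harm k - 1)"
      using less.hyps[of k V] less.prems(2) sp cU by auto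
    have "card (insert y C) \<le> 1 + real (card C)"
      using card_insert_le_m1[of "Suc (card C)" C y] C by (simp add: card_insert_if)
    also have "\<dots> \<le> 1 + (card V / k + t * (harm k - 1))"
      using C by simp
    also have "\<dots> = card U / k + t * (harm k - 1)"
      using less.prems(2) cU by (simp add: field_simps)
    finally show ?thesis
      using C full by (intro exI[of _ "insert y C"]) (auto simp: V_def)
  next
    case sparse
    have cU: "card U \<le> real (k - 1) * t"
      using few[OF less.prems(1) sparse(2)] .
    have "k \<noteq> 1"
      using cU sparse(1) finU by auto
    then obtain j where k: "k = Suc j" "1 \<le> j"
      using less.prems(2) by (cases k) auto
    obtain C where C: "C \<subseteq> F" "finite C" "\<forall>p\<in>U. C \<inter> T p \<noteq> {}"
        "card C \<le> card U / j + t * (harm j - 1)"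
      using less.hyps[of j U] less.prems sparse k by auto
    have "card U / j * k = card U + card U / j"
      using k by (simp add: field_simps)
    then have "card U / j = card U / k + (card U / j) / k"
      using less.prems(2) by (simp add: field_simps)
    also have "\<dots> \<le> card U / k + t / k"
      using cU k by (intro add_left_mono divide_right_mono) (auto simp: field_simps)
    finally have "card U / j + t * (harm j - 1) \<le> card U / k + t * (harm k - 1)"
      by (simp add: k harm_Suc algebra_simps divide_inverse)
    then show ?thesis
      using C by (intro exI[of _ C]) auto
  qed
qed

text \<open>Here \<^term>\<open>measure M F / v\<close> is the size of a fractional cover: spread weight over \<open>F\<close> with
  density \<open>1 / v\<close>. Double counting the pairs of a point in \<open>U\<close> and an index in \<open>F\<close> shows that a family whose
  sets meet \<open>U\<close> in at most \<open>k\<close> points can only exist if \<open>U\<close> has at most \<open>k\<close> times this many points,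
  which is what the greedy algorithm needs.\<close>

lemma greedy_cover:
  fixes T :: "'p \<Rightarrow> 'a set" and v :: real
  assumes "finite P" "F \<in> fmeasurable M" "0 < v" "1 \<le> d"
    and T: "\<And>p. p \<in> P \<Longrightarrow> T p \<in> sets M" "\<And>p. p \<in> P \<Longrightarrow> T p \<subseteq> F"
    and vol: "\<And>p. p \<in> P \<Longrightarrow> v \<le> measure M (T p)"
    and deg: "\<And>y. y \<in> F \<Longrightarrow> card {p \<in> P. y \<in> T p} \<le> d"
  shows "\<exists>C\<subseteq>F. finite C \<and> (\<forall>p\<in>P. C \<inter> T p \<noteq> {}) \<and> card C \<le> measure M F / v * harm d"
proof -
  define t where "t = measure M F / v"
  \<comment> \<open>The double counting: both bounds are applied to the integral over \<open>F\<close> of the degree in \<open>U\<close>.\<close>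
  have few: "card U \<le> k * t" if U: "U \<subseteq> P" and k: "\<forall>y\<in>F. card {p \<in> U. y \<in> T p} \<le> k" for U k
  proof -
    have finU: "finite U"
      using U \<open>finite P\<close> finite_subset by blast
    have Tf: "T p \<in> fmeasurable M" if "p \<in> U" for p
      using T that U assms(2) by (meson fmeasurableI2 subsetD)
    then have int: "integrable M (indicat_real (T p))" if "p \<in> U" for p
      using that by (simp add: fmeasurable_def integrable_real_indicator)
    have "card U * v \<le> (\<Sum>p\<in>U. measure M (T p))"
      using vol U by (intro sum_bounded_below) auto
    also have "\<dots> = (\<Sum>p\<in>U. \<integral>y. indicat_real (T p) y \<partial>M)"
      using Tf by (intro sum.cong) (auto simp: fmeasurable_def sets.Int_space_eq2)
    also have "\<dots> = (\<integral>y. (\<Sum>p\<in>U. indicat_real (T p) y) \<partial>M)"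
      using int by (subst Bochner_Integration.integral_sum) auto
    also have "\<dots> \<le> (\<integral>y. k * indicat_real F y \<partial>M)"
    proof (rule integral_mono)
      show "integrable M (\<lambda>y. \<Sum>p\<in>U. indicat_real (T p) y)"
        using int by auto
      show "integrable M (\<lambda>y. k * indicat_real F y)"
        using assms(2)
        by (intro integrable_mult_right) (simp add: fmeasurable_def integrable_real_indicator)
      fix y
      have "(\<Sum>p\<in>U. indicat_real (T p) y) = (\<Sum>p\<in>U. if y \<in> T p then 1 else 0)"
        by (intro sum.cong) (auto simp: indicator_def)
      also have "\<dots> = card {p \<in> U. y \<in> T p}"
        by (subst sum.inter_filter[OF finU, symmetric]) simp
      finally have "(\<Sum>p\<in>U. indicat_real (T p) y) = card {p \<in> U. y \<in> T p}" .
      moreover have "card {p \<in> U. y \<in> T p} \<le> k" if "y \<in> F"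
        using k that by blast
      moreover have "{p \<in> U. y \<in> T p} = {}" if "y \<notin> F"
        using T(2) U that by fast
      ultimately show "(\<Sum>p\<in>U. indicat_real (T p) y) \<le> k * indicat_real F y"
        by (auto simp: indicator_def)
    qed
    also have "\<dots> = k * measure M F"
      using assms(2) by (simp add: fmeasurable_def sets.Int_space_eq2)
    finally show ?thesis
      using \<open>0 < v\<close> by (simp add: t_def field_simps)
  qed
  have "0 \<le> t"
    using \<open>0 < v\<close> by (simp add: t_def)
  obtain C where C: "C \<subseteq> F" "finite C" "\<forall>p\<in>P. C \<inter> T p \<noteq> {}" "card C \<le> card P / d + t * (harm d - 1)"
    using greedy_cover_step_bound[OF \<open>finite P\<close> \<open>0 \<le> t\<close>, of F T P d] few deg \<open>1 \<le> d\<close> by auto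
  have "card P / d \<le> t"
    using few[of P d] deg \<open>1 \<le> d\<close> by (simp add: field_simps)
  then have "card C \<le> t * harm d"
    using C(4) by (simp add: algebra_simps)
  then show ?thesis
    using C by (auto simp: t_def)
qed

section \<open>The cubic lattice and its torus\<close>

text \<open>The torus is not formed as a quotient. Its points are represented in the half-open cube
  \<open>cell\<close>, and statements about it are statements modulo the lattice.\<close>

definition cubic_lattice :: "real \<Rightarrow> (real ^ 'n) set" where
  "cubic_lattice L = {v. \<forall>i. \<exists>k::int. v $ i = L * of_int k}"

definition cell :: "real \<Rightarrow> (real ^ 'n) set" where
  "cell L = {x. \<forall>i. 0 \<le> x $ i \<and> x $ i < L}"

lemma cubic_lattice_zero [simp]: "0 \<in> cubic_lattice L"
  by (auto simp: cubic_lattice_def intro: exI[of _ 0])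

lemma cubic_lattice_add: "u \<in> cubic_lattice L \<Longrightarrow> v \<in> cubic_lattice L \<Longrightarrow> u + v \<in> cubic_lattice L"
  unfolding cubic_lattice_def mem_Collect_eq
proof
  fix i assume "\<forall>i. \<exists>k::int. u $ i = L * of_int k" "\<forall>i. \<exists>k::int. v $ i = L * of_int k"
  then obtain j k :: int where "u $ i = L * of_int j" "v $ i = L * of_int k"
    by blast
  then show "\<exists>k::int. (u + v) $ i = L * of_int k"
    by (intro exI[of _ "j + k"]) (simp add: algebra_simps)
qed

lemma cubic_lattice_uminus: "v \<in> cubic_lattice L \<Longrightarrow> - v \<in> cubic_lattice L"
  unfolding cubic_lattice_def mem_Collect_eq
proof
  fix i assume "\<forall>i. \<exists>k::int. v $ i = L * of_int k"
  then obtain k :: int where "v $ i = L * of_int k"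
    by blast
  then show "\<exists>k::int. (- v) $ i = L * of_int k"
    by (intro exI[of _ "- k"]) simp
qed

lemma cubic_lattice_diff: "u \<in> cubic_lattice L \<Longrightarrow> v \<in> cubic_lattice L \<Longrightarrow> u - v \<in> cubic_lattice L"
  using cubic_lattice_add[OF _ cubic_lattice_uminus, of u L v] by simp

lemma countable_cubic_lattice: "countable (cubic_lattice L :: (real ^ 'n) set)"
proof -
  have "cubic_lattice L \<subseteq> range (\<lambda>z :: int ^ 'n. \<chi> i. L * of_int (z $ i))"
  proof
    fix v :: "real ^ 'n" assume "v \<in> cubic_lattice L"
    then obtain k :: "'n \<Rightarrow> int" where "\<And>i. v $ i = L * of_int (k i)"
      unfolding cubic_lattice_def by (auto dest!: choice)
    then show "v \<in> range (\<lambda>z :: int ^ 'n. \<chi> i. L * of_int (z $ i))"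
      by (intro image_eqI[of _ _ "\<chi> i. k i"]) (auto simp: vec_eq_iff)
  qed
  then show ?thesis
    by (rule countable_subset) simp
qed

lemma cubic_lattice_small_eq_0:
  assumes "v \<in> cubic_lattice L" "\<And>i. \<bar>v $ i\<bar> < L"
  shows "v = 0"
proof -
  have "v $ i = 0" for i
  proof -
    obtain k :: int where k: "v $ i = L * of_int k"
      using assms(1) by (auto simp: cubic_lattice_def)
    have "0 < L"
      using assms(2)[of i] by linarith
    then have "of_int \<bar>k\<bar> < (of_int 1 :: real)"
      using assms(2)[of i] by (simp add: k abs_mult)
    then have "k = 0"
      unfolding of_int_less_iff by simp
    then show ?thesis
      by (simp add: k)
  qed
  then show ?thesis
    by (simp add: vec_eq_iff)
qed

lemma cell_reduction:
  assumes "0 < L"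
  shows "\<exists>l\<in>cubic_lattice L. x - l \<in> cell L"
proof (intro bexI[of _ "\<chi> i. L * of_int \<lfloor>x $ i / L\<rfloor>"])
  have "L * of_int \<lfloor>t / L\<rfloor> \<le> t \<and> t < L * of_int \<lfloor>t / L\<rfloor> + L" for t
    using assms floor_divide_lower[of L t] floor_divide_upper[of L t] by (auto simp: algebra_simps)
  then show "x - (\<chi> i. L * of_int \<lfloor>x $ i / L\<rfloor>) \<in> cell L"
    by (simp add: cell_def diff_less_eq add.commute)
qed (auto simp: cubic_lattice_def)

lemma cell_reduction_unique:
  assumes "l \<in> cubic_lattice L" "m \<in> cubic_lattice L" "x - l \<in> cell L" "x - m \<in> cell L"
  shows "l = m"
proof -
  have "\<bar>(l - m) $ i\<bar> < L" for i
  proof -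
    have "0 \<le> x $ i - l $ i" "x $ i - l $ i < L" "0 \<le> x $ i - m $ i" "x $ i - m $ i < L"
      using assms(3,4) by (auto simp: cell_def)
    then show ?thesis
      by simp
  qed
  then show ?thesis
    using cubic_lattice_small_eq_0[OF cubic_lattice_diff[OF assms(1,2)]] by simp
qed

lemma measure_cbox_cube:
  assumes "a \<le> b"
  shows "measure lebesgue (cbox (\<chi> i. a) (\<chi> i. b) :: (real ^ 'n) set) = (b - a) ^ CARD('n)"
proof -
  have "(cbox (\<chi> i. a) (\<chi> i. b) :: (real ^ 'n) set) \<noteq> {}"
    using assms by (auto simp: interval_eq_empty_cart not_less)
  then show ?thesis
    using content_cbox_cart[of "(\<chi> i. a) :: real ^ 'n" "\<chi> i. b"] by simp
qed

lemma cell_lmeasurable: "(cell L :: (real ^ 'n) set) \<in> lmeasurable"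
proof (rule bounded_set_imp_lmeasurable)
  have "(cell L :: (real ^ 'n) set) \<subseteq> cbox (\<chi> i. 0) (\<chi> i. L)"
    by (auto simp: cell_def mem_box_cart less_imp_le)
  then show "bounded (cell L :: (real ^ 'n) set)"
    using bounded_cbox bounded_subset by blast
  have "(cell L :: (real ^ 'n) set) \<in> sets borel"
    unfolding cell_def by measurable
  then show "(cell L :: (real ^ 'n) set) \<in> sets lebesgue"
    by simp
qed

lemma measure_cell:
  assumes "0 < L"
  shows "measure lebesgue (cell L :: (real ^ 'n) set) = L ^ CARD('n)"
proof (rule antisym)
  have sub: "box (\<chi> i. 0) (\<chi> i. L) \<subseteq> (cell L :: (real ^ 'n) set)"
    "(cell L :: (real ^ 'n) set) \<subseteq> cbox (\<chi> i. 0) (\<chi> i. L)"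
    by (auto simp: cell_def mem_box_cart less_imp_le)
  have eq: "measure lebesgue (cbox (\<chi> i. 0) (\<chi> i. L) :: (real ^ 'n) set) = L ^ CARD('n)"
    using measure_cbox_cube[of 0 L] assms by simp
  show "measure lebesgue (cell L :: (real ^ 'n) set) \<le> L ^ CARD('n)"
    using measure_mono_fmeasurable[OF sub(2) fmeasurableD[OF cell_lmeasurable] lmeasurable_cbox] eq
    by linarith
  have "L ^ CARD('n) = measure lebesgue (box (\<chi> i. 0) (\<chi> i. L) :: (real ^ 'n) set)"
    using eq by (simp add: measure_lborel_box_eq measure_lborel_cbox_eq)
  also have "\<dots> \<le> measure lebesgue (cell L :: (real ^ 'n) set)"
    by (rule measure_mono_fmeasurable[OF sub(1) fmeasurableD[OF lmeasurable_box] cell_lmeasurable])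
  finally show "L ^ CARD('n) \<le> measure lebesgue (cell L :: (real ^ 'n) set)" .
qed

lemma emeasure_lebesgue_translation:
  fixes S :: "'a::euclidean_space set"
  shows "emeasure lebesgue ((+) a ` S) = emeasure lebesgue S"
  using emeasure_lebesgue_affine[of 1 a S] by (simp add: add.commute cong: image_cong_simp)

text \<open>Projection to the torus preserves the volume of a set on which it is injective: \<open>W\<close> and \<open>B\<close>
  are split by the translates of the cell into countably many pieces that correspond to each other
  under lattice translations.\<close>

lemma measure_wrapped_set:
  fixes B :: "(real ^ 'n) set"
  assumes "0 < L" "B \<in> lmeasurable"
    and inj: "\<And>a b. a \<in> B \<Longrightarrow> b \<in> B \<Longrightarrow> a - b \<in> cubic_lattice L \<Longrightarrow> a = b"
  defines "W \<equiv> {y \<in> cell L. \<exists>l\<in>cubic_lattice L. y + l \<in> B}"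
  shows "W \<in> sets lebesgue" "measure lebesgue W = measure lebesgue B"
proof -
  let ?\<Lambda> = "cubic_lattice L :: (real ^ 'n) set"
  let ?F = "cell L :: (real ^ 'n) set"
  have F: "?F \<in> sets lebesgue" and B: "B \<in> sets lebesgue"
    using cell_lmeasurable assms(2) by (auto dest: fmeasurableD)
  have W: "W = (\<Union>l\<in>?\<Lambda>. ?F \<inter> (+) l ` B)"
  proof (intro set_eqI iffI)
    fix y assume "y \<in> W"
    then obtain l where l: "y \<in> ?F" "l \<in> ?\<Lambda>" "y + l \<in> B"
      by (auto simp: W_def)
    then have "y \<in> (+) (- l) ` B"
      by (intro image_eqI[of _ _ "y + l"]) auto
    then show "y \<in> (\<Union>l\<in>?\<Lambda>. ?F \<inter> (+) l ` B)"
      using l cubic_lattice_uminus by blast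
  next
    fix y assume "y \<in> (\<Union>l\<in>?\<Lambda>. ?F \<inter> (+) l ` B)"
    then obtain l b where l: "y \<in> ?F" "l \<in> ?\<Lambda>" "b \<in> B" "y = l + b"
      by auto
    then have "- l \<in> ?\<Lambda>" "y + - l \<in> B"
      by (auto intro: cubic_lattice_uminus)
    then show "y \<in> W"
      using l(1) unfolding W_def by blast
  qed
  have B_split: "B = (\<Union>l\<in>?\<Lambda>. (+) (- l) ` ?F \<inter> B)"
  proof (intro set_eqI iffI)
    fix b assume "b \<in> B"
    obtain l where l: "l \<in> ?\<Lambda>" "b - l \<in> ?F"
      using cell_reduction[OF \<open>0 < L\<close>] by blast
    have "b \<in> (+) (- (- l)) ` ?F"
      using l by (intro image_eqI[of _ _ "b - l"]) auto
    then show "b \<in> (\<Union>l\<in>?\<Lambda>. (+) (- l) ` ?F \<inter> B)"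
      using cubic_lattice_uminus[OF l(1)] \<open>b \<in> B\<close> by blast
  qed auto
  have meas1: "?F \<inter> (+) l ` B \<in> sets lebesgue" for l
    by (rule sets.Int[OF F lebesgue_sets_translation[OF B]])
  have meas2: "(+) (- l) ` ?F \<inter> B \<in> sets lebesgue" for l
    by (rule sets.Int[OF lebesgue_sets_translation[OF F] B])
  have disj1: "disjoint_family_on (\<lambda>l. ?F \<inter> (+) l ` B) ?\<Lambda>"
  proof (unfold disjoint_family_on_def, intro ballI impI)
    fix l m assume lm: "l \<in> ?\<Lambda>" "m \<in> ?\<Lambda>" "l \<noteq> m"
    show "(?F \<inter> (+) l ` B) \<inter> (?F \<inter> (+) m ` B) = {}"
    proof (rule ccontr)
      assume "\<not> ?thesis"
      then obtain a b where ab: "a \<in> B" "b \<in> B" "l + a = m + b"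
        by blast
      then have "a - b = m - l"
        by (simp add: algebra_simps)
      then have "a = b"
        using inj[OF ab(1,2)] cubic_lattice_diff[OF lm(2,1)] by simp
      then show False
        using ab lm by simp
    qed
  qed
  have disj2: "disjoint_family_on (\<lambda>l. (+) (- l) ` ?F \<inter> B) ?\<Lambda>"
  proof (unfold disjoint_family_on_def, intro ballI impI)
    fix l m assume lm: "l \<in> ?\<Lambda>" "m \<in> ?\<Lambda>" "l \<noteq> m"
    show "((+) (- l) ` ?F \<inter> B) \<inter> ((+) (- m) ` ?F \<inter> B) = {}"
    proof (rule ccontr)
      assume "\<not> ?thesis"
      then obtain a b where ab: "a \<in> ?F" "b \<in> ?F" "- l + a = - m + b"
        by blast
      have "(- l + a) - (- l) = a" "(- l + a) - (- m) = b"
        using ab(3) by (simp_all add: algebra_simps)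
      then have "(- l + a) - (- l) \<in> ?F" "(- l + a) - (- m) \<in> ?F"
        using ab(1,2) by simp_all
      then have "- l = - m"
        by (rule cell_reduction_unique[OF cubic_lattice_uminus[OF lm(1)] cubic_lattice_uminus[OF lm(2)]])
      then show False
        using lm(3) by simp
    qed
  qed
  have shift: "(+) l ` ((+) (- l) ` ?F \<inter> B) = ?F \<inter> (+) l ` B" for l
    by (subst image_Int) (simp_all add: image_image)
  have same_volume: "emeasure lebesgue (?F \<inter> (+) l ` B) = emeasure lebesgue ((+) (- l) ` ?F \<inter> B)" for l
    using emeasure_lebesgue_translation[of l "(+) (- l) ` ?F \<inter> B"] unfolding shift .
  show Wm: "W \<in> sets lebesgue"
    unfolding W by (rule sets.countable_UN''[OF countable_cubic_lattice meas1])
  have "emeasure lebesgue W = (\<integral>\<^sup>+l. emeasure lebesgue (?F \<inter> (+) l ` B) \<partial>count_space ?\<Lambda>)"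
    unfolding W by (rule emeasure_UN_countable[OF meas1 countable_cubic_lattice disj1])
  also have "\<dots> = (\<integral>\<^sup>+l. emeasure lebesgue ((+) (- l) ` ?F \<inter> B) \<partial>count_space ?\<Lambda>)"
    by (simp only: same_volume)
  also have "\<dots> = emeasure lebesgue (\<Union>l\<in>?\<Lambda>. (+) (- l) ` ?F \<inter> B)"
    by (rule emeasure_UN_countable[OF meas2 countable_cubic_lattice disj2, symmetric])
  also have "\<dots> = emeasure lebesgue B"
    by (rule arg_cong[OF B_split[symmetric]])
  finally show "measure lebesgue W = measure lebesgue B"
    by (simp only: measure_def)
qed

section \<open>Covering the torus\<close>

text \<open>A separated subset of the torus has boundedly many points by volume; one with the largest number
  of points is also a \<open>\<delta>\<close>-net. Separation compares different points only, since a body is later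
  packed with one representative of each point.\<close>

lemma saturated_separated_set_exists:
  assumes "0 < L" "0 < \<delta>"
  obtains S :: "(real ^ 'n) set" where "finite S"
    "\<And>p q l. p \<in> S \<Longrightarrow> q \<in> S \<Longrightarrow> l \<in> cubic_lattice L \<Longrightarrow> p \<noteq> q \<Longrightarrow> \<delta> < norm (p - q + l)"
    "\<And>x. \<exists>p\<in>S. \<exists>l\<in>cubic_lattice L. norm (x - p - l) \<le> \<delta>"
proof -
  define sep where "sep S \<longleftrightarrow> S \<subseteq> cell L \<and> finite S \<and>
    (\<forall>p\<in>S. \<forall>q\<in>S. \<forall>l\<in>cubic_lattice L. p \<noteq> q \<longrightarrow> \<delta> < norm (p - q + l))" for S :: "(real ^ 'n) set"
  have "bounded (cell L :: (real ^ 'n) set)"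
    by (rule bounded_subset[OF bounded_cbox[of "\<chi> i. 0" "\<chi> i. L"]])
      (auto simp: cell_def mem_box_cart less_imp_le)
  then obtain r where r: "\<And>x :: real ^ 'n. x \<in> cell L \<Longrightarrow> norm x \<le> r"
    unfolding bounded_iff by blast
  let ?b = "measure lebesgue (cball (0 :: real ^ 'n) (\<delta> / 2))"
  let ?w = "measure lebesgue (cball (0 :: real ^ 'n) (r + \<delta> / 2))"
  have b: "0 < ?b"
    using \<open>0 < \<delta>\<close> content_cball_pos[of "\<delta> / 2" "0 :: real ^ 'n"] by simp
  have bound: "card S * ?b \<le> ?w" if "sep S" for S :: "(real ^ 'n) set"
  proof (rule card_disjoint_translates_le)
    show "finite S"
      using that by (simp add: sep_def)
    fix p q assume "p \<in> S" "q \<in> S" "p \<noteq> q"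
    then have "\<delta> < norm (p - q + 0)"
      using that cubic_lattice_zero unfolding sep_def by blast
    then show "disjnt ((+) p ` cball 0 (\<delta> / 2)) ((+) q ` cball 0 (\<delta> / 2))"
      using disjoint_cballI[of "\<delta> / 2" "\<delta> / 2" p q]
      by (simp add: disjnt_def dist_norm)
  next
    fix p assume "p \<in> S"
    then have "norm p \<le> r"
      using that r by (auto simp: sep_def)
    show "(+) p ` cball 0 (\<delta> / 2) \<subseteq> cball 0 (r + \<delta> / 2)"
    proof (rule image_subsetI)
      fix y :: "real ^ 'n" assume "y \<in> cball 0 (\<delta> / 2)"
      then show "p + y \<in> cball 0 (r + \<delta> / 2)"
        using norm_triangle_ineq[of p y] \<open>norm p \<le> r\<close> by simp
    qed
  qed auto
  have "sep {}"
    by (simp add: sep_def)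
  moreover have "\<forall>S. sep S \<longrightarrow> card S < Suc (nat \<lfloor>?w / ?b\<rfloor>)"
  proof (intro allI impI)
    fix S :: "(real ^ 'n) set" assume "sep S"
    then have "card S \<le> ?w / ?b"
      using bound b by (simp add: field_simps)
    then show "card S < Suc (nat \<lfloor>?w / ?b\<rfloor>)"
      by (simp add: le_nat_floor less_Suc_eq_le)
  qed
  ultimately obtain S where S: "sep S" and max: "\<And>T. sep T \<Longrightarrow> card T \<le> card S"
    using Lattices_Big.ex_has_greatest_nat[of sep "{}" card] by metis
  have near: "\<exists>p\<in>S. \<exists>l\<in>cubic_lattice L. norm (x - p - l) \<le> \<delta>" if x: "x \<in> cell L" for x
  proof (rule ccontr)
    assume far: "\<not> ?thesis"
    have farx: "\<delta> < norm (x - p + l)" if "p \<in> S" "l \<in> cubic_lattice L" for p l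
      using far that cubic_lattice_uminus[OF that(2)] by fastforce
    have farx': "\<delta> < norm (p - x + l)" if "p \<in> S" "l \<in> cubic_lattice L" for p l
    proof -
      have "norm (p - x + l) = norm (x - p + - l)"
        by (subst norm_minus_cancel[symmetric]) (simp add: algebra_simps)
      then show ?thesis
        using farx[OF that(1) cubic_lattice_uminus[OF that(2)]] by simp
    qed
    have "x \<notin> S"
      using farx[of x 0] \<open>0 < \<delta>\<close> by auto
    moreover have "sep (insert x S)"
      using S x farx farx' unfolding sep_def by auto
    ultimately show False
      using max[of "insert x S"] S by (simp add: sep_def)
  qed
  show ?thesis
  proof (rule that[of S])
    show "finite S"
      using S by (simp add: sep_def)
    show "\<delta> < norm (p - q + l)" if "p \<in> S" "q \<in> S" "l \<in> cubic_lattice L" "p \<noteq> q" for p q l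
      using S that unfolding sep_def by blast
    fix x :: "real ^ 'n"
    obtain m where m: "m \<in> cubic_lattice L" "x - m \<in> cell L"
      using cell_reduction[OF \<open>0 < L\<close>] by blast
    obtain p l where p: "p \<in> S" "l \<in> cubic_lattice L" "norm (x - m - p - l) \<le> \<delta>"
      using near[OF m(2)] by blast
    have "x - m - p - l = x - p - (m + l)"
      by simp
    then show "\<exists>p\<in>S. \<exists>l\<in>cubic_lattice L. norm (x - p - l) \<le> \<delta>"
      using p cubic_lattice_add[OF m(1) p(2)] by metis
  qed
qed

definition covers_torus :: "real \<Rightarrow> (real ^ 'n) set \<Rightarrow> (real ^ 'n) set \<Rightarrow> bool" where
  "covers_torus L K C \<longleftrightarrow> (\<forall>x. \<exists>c\<in>C. \<exists>l\<in>cubic_lattice L. x - (c + l) \<in> K)"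

text \<open>It suffices to cover the net \<open>S\<close> by translates of \<^term>\<open>inner_parallel_body \<delta> K\<close>, since these
  stay within translates of \<open>K\<close> when fattened by \<open>\<delta>\<close>. The index set for the greedy cover is the whole
  torus with its uniform measure. The hypothesis on \<open>L\<close> makes \<open>K\<close> embed into the torus, so each
  point of \<open>S\<close> is covered by a set of translations of full volume; the packing bound gives the
  degree \<open>d\<close>. The demand on \<open>L\<close> involves \<open>K\<close> alone, so that one torus serves all \<open>\<delta>\<close>.\<close>

lemma torus_covering_exists:
  fixes K :: "(real ^ 'n) set"
  assumes K: "\<And>x. x \<in> K \<Longrightarrow> norm x \<le> R" and "0 < L" "2 * R < L" and "0 < \<delta>"
    and pos: "0 < measure lebesgue (inner_parallel_body \<delta> K)"
  shows "\<exists>C. finite C \<and> covers_torus L K C \<and>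
    card C \<le> L ^ CARD('n) / measure lebesgue (inner_parallel_body \<delta> K) *
      (1 + ln (measure lebesgue (inner_parallel_body (\<delta> / 2) K) /
               measure lebesgue (cball (0 :: real ^ 'n) (\<delta> / 2))))"
proof -
  let ?A = "inner_parallel_body \<delta> K" and ?H = "inner_parallel_body (\<delta> / 2) K"
  let ?b = "measure lebesgue (cball (0 :: real ^ 'n) (\<delta> / 2))"
  have bdd: "bounded K"
    using K unfolding bounded_iff by blast
  have Am: "?A \<in> lmeasurable" and Hm: "?H \<in> lmeasurable"
    using inner_parallel_body_lmeasurable[OF _ bdd] \<open>0 < \<delta>\<close> by auto
  have b: "0 < ?b"
    using \<open>0 < \<delta>\<close> content_cball_pos[of "\<delta> / 2" "0 :: real ^ 'n"] by simp
  obtain S :: "(real ^ 'n) set" where S: "finite S"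
    and sep: "\<And>p q l. p \<in> S \<Longrightarrow> q \<in> S \<Longrightarrow> l \<in> cubic_lattice L \<Longrightarrow> p \<noteq> q \<Longrightarrow> \<delta> < norm (p - q + l)"
    and sat: "\<And>x. \<exists>p\<in>S. \<exists>l\<in>cubic_lattice L. norm (x - p - l) \<le> \<delta>"
    using saturated_separated_set_exists[OF \<open>0 < L\<close> \<open>0 < \<delta>\<close>] by blast
  have packing: "card Q * ?b \<le> measure lebesgue ?H"
    if Q: "finite Q" "Q \<subseteq> ?A" "\<And>p q. p \<in> Q \<Longrightarrow> q \<in> Q \<Longrightarrow> p \<noteq> q \<Longrightarrow> \<delta> < norm (p - q)" for Q
  proof (rule card_disjoint_translates_le[OF _ Hm Q(1)])
    fix p q assume "p \<in> Q" "q \<in> Q" "p \<noteq> q"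
    then show "disjnt ((+) p ` cball 0 (\<delta> / 2)) ((+) q ` cball 0 (\<delta> / 2))"
      using disjoint_cballI[of "\<delta> / 2" "\<delta> / 2" p q] Q(3)[of p q]
      by (simp add: disjnt_def dist_norm)
  next
    fix p assume "p \<in> Q"
    then show "(+) p ` cball 0 (\<delta> / 2) \<subseteq> ?H"
      using cball_half_subset_inner_parallel_body[of p \<delta> K] Q(2) \<open>0 < \<delta>\<close> by auto
  qed auto
  \<comment> \<open>\<open>y \<in> T p\<close> means that translation by \<open>- y\<close> covers \<open>p\<close>. Using \<open>- y\<close> rather than \<open>y\<close> as the index
    makes \<open>T p\<close> the projection of a translate of the body, with no reflection.\<close>
  define T where "T p = {y \<in> cell L. \<exists>l\<in>cubic_lattice L. y + l \<in> (+) (- p) ` ?A}" for p :: "real ^ 'n"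
  have inj: "u = w" if uw: "u \<in> (+) (- p) ` ?A" "w \<in> (+) (- p) ` ?A" "u - w \<in> cubic_lattice L" for p u w
  proof -
    obtain a c where ac: "a \<in> ?A" "c \<in> ?A" "u = - p + a" "w = - p + c"
      using uw by blast
    have "norm (u - w) < L"
      using ac norm_triangle_ineq4[of a c] K[of a] K[of c] inner_parallel_body_subset[of \<delta> K] \<open>2 * R < L\<close>
      by (auto simp: subset_eq)
    then have "\<bar>(u - w) $ i\<bar> < L" for i
      using component_le_norm_cart[of "u - w" i] by linarith
    then show ?thesis
      using cubic_lattice_small_eq_0[OF uw(3)] by simp
  qed
  have T: "T p \<in> sets lebesgue" "measure lebesgue (T p) = measure lebesgue ?A" for p
    using measure_wrapped_set[OF \<open>0 < L\<close> measurable_translation[OF Am, of "- p"] inj[of _ p]]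
    by (simp_all add: T_def measure_translation_subtract)
  have T_sub: "T p \<subseteq> cell L" for p
    by (auto simp: T_def)
  define d where "d = nat \<lfloor>measure lebesgue ?H / ?b\<rfloor>"
  have deg_le: "card Q \<le> d"
    if Q: "finite Q" "Q \<subseteq> ?A" "\<And>p q. p \<in> Q \<Longrightarrow> q \<in> Q \<Longrightarrow> p \<noteq> q \<Longrightarrow> \<delta> < norm (p - q)" for Q
    using packing[OF that] b unfolding d_def by (intro le_nat_floor) (simp add: field_simps)
  have "?A \<noteq> {}"
    using pos by auto
  then obtain a where "a \<in> ?A"
    by blast
  then have d1: "1 \<le> d"
    using deg_le[of "{a}"] by simp
  have deg: "card {p \<in> S. y \<in> T p} \<le> d" for y
  proof -
    have "\<exists>l\<in>cubic_lattice L. p + y + l \<in> ?A" if y: "y \<in> T p" for p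
    proof -
      obtain l a where "l \<in> cubic_lattice L" "a \<in> ?A" "y + l = - p + a"
        using y unfolding T_def by blast
      moreover from this have "p + y + l = a"
        by (simp add: algebra_simps)
      ultimately show ?thesis
        by blast
    qed
    then obtain l where l: "\<And>p. y \<in> T p \<Longrightarrow> l p \<in> cubic_lattice L \<and> p + y + l p \<in> ?A"
      by metis
    \<comment> \<open>Representatives, inside one translate of the body, of the points covered by \<open>y\<close>.\<close>
    let ?P = "{p \<in> S. y \<in> T p}"
    have far: "\<delta> < norm ((p + y + l p) - (q + y + l q))" if "p \<in> ?P" "q \<in> ?P" "p \<noteq> q" for p q
    proof -
      have eq: "(p + y + l p) - (q + y + l q) = p - q + (l p - l q)"
        by simp
      have "l p - l q \<in> cubic_lattice L"
        using that l by (intro cubic_lattice_diff) auto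
      then show ?thesis
        unfolding eq using that by (intro sep) auto
    qed
    have "inj_on (\<lambda>p. p + y + l p) ?P"
    proof (rule inj_onI, rule ccontr)
      fix p q assume pq: "p \<in> ?P" "q \<in> ?P" "p + y + l p = q + y + l q" "p \<noteq> q"
      show False
        using far[OF pq(1,2,4)] \<open>0 < \<delta>\<close> unfolding pq(3) by simp
    qed
    then have "card ?P = card ((\<lambda>p. p + y + l p) ` ?P)"
      by (simp add: card_image)
    also have "\<dots> \<le> d"
    proof (rule deg_le)
      show "finite ((\<lambda>p. p + y + l p) ` ?P)"
        using S by simp
      show "(\<lambda>p. p + y + l p) ` ?P \<subseteq> ?A"
        using l by blast
      fix u w assume uw: "u \<in> (\<lambda>p. p + y + l p) ` ?P" "w \<in> (\<lambda>p. p + y + l p) ` ?P" "u \<noteq> w"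
      then obtain p q where pq: "p \<in> ?P" "u = p + y + l p" "q \<in> ?P" "w = q + y + l q"
        by blast
      then have "p \<noteq> q"
        using uw(3) by blast
      then show "\<delta> < norm (u - w)"
        unfolding pq(2,4) by (rule far[OF pq(1,3)])
    qed
    finally show ?thesis .
  qed
  obtain C where C: "C \<subseteq> cell L" "finite C" "\<forall>p\<in>S. C \<inter> T p \<noteq> {}"
    "card C \<le> measure lebesgue (cell L :: (real ^ 'n) set) / measure lebesgue ?A * harm d"
    using greedy_cover[OF S cell_lmeasurable pos d1 T(1) T_sub eq_refl[OF T(2)[symmetric]] deg] by blast
  have "covers_torus L K (uminus ` C)"
    unfolding covers_torus_def
  proof
    fix x :: "real ^ 'n"
    obtain p m where p: "p \<in> S" "m \<in> cubic_lattice L" "norm (x - p - m) \<le> \<delta>"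
      using sat by blast
    obtain y where y: "y \<in> C" "y \<in> T p"
      using C(3) p(1) by blast
    then obtain l a where l: "l \<in> cubic_lattice L" "a \<in> ?A" "y + l = - p + a"
      unfolding T_def by blast
    have eq: "x - (- y + (m - l)) = a + (x - p - m)"
      using l(3) by (simp add: algebra_simps)
    have "a + (x - p - m) \<in> cball a \<delta>"
    proof -
      have "dist (a + (x - p - m)) a = norm (x - p - m)"
        by (simp only: dist_norm add_diff_cancel_left')
      then show ?thesis
        using p(3) by (simp only: mem_cball dist_commute)
    qed
    moreover have "cball a \<delta> \<subseteq> K"
      using l(2) by (simp add: inner_parallel_body_def)
    ultimately have "x - (- y + (m - l)) \<in> K"
      unfolding eq by (rule rev_subsetD)
    then show "\<exists>c\<in>uminus ` C. \<exists>l\<in>cubic_lattice L. x - (c + l) \<in> K"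
      using y(1) cubic_lattice_diff[OF p(2) l(1)] by blast
  qed
  moreover have "card (uminus ` C) = card C"
    by (intro card_image) (simp add: inj_on_def)
  moreover have "harm d \<le> 1 + ln (measure lebesgue ?H / ?b)"
  proof -
    have "real d \<le> measure lebesgue ?H / ?b"
      unfolding d_def by (rule of_nat_floor) simp
    then have "ln (real d) \<le> ln (measure lebesgue ?H / ?b)"
      using d1 by (intro ln_mono) auto
    then show ?thesis
      using harm_le_one_plus_ln[OF d1] by simp
  qed
  then have "L ^ CARD('n) / measure lebesgue ?A * harm d \<le>
      L ^ CARD('n) / measure lebesgue ?A * (1 + ln (measure lebesgue ?H / ?b))"
    using \<open>0 < L\<close> by (intro mult_left_mono) auto
  ultimately show ?thesis
    using C measure_cell[OF \<open>0 < L\<close>, where 'n = 'n] by (intro exI[of _ "uminus ` C"]) auto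
qed

section \<open>Density of a lattice-periodic covering\<close>

lemma translated_copy_eq: "translated_copy K v = (+) v ` K"
  by (simp add: translated_copy_def add.commute)

text \<open>The cells attached to the translation vectors are disjoint and stay in a slightly larger cube;
  compare volumes.\<close>

lemma translates_meeting_cube_bound:
  fixes K :: "(real ^ 'n) set" and c :: "real ^ 'n"
  assumes K: "\<And>x. x \<in> K \<Longrightarrow> norm x \<le> R" and "0 < L" "0 \<le> R" "0 \<le> a"
  defines "D \<equiv> {l \<in> cubic_lattice L. translated_copy K (c + l) \<inter> centred_cube a \<noteq> {}}"
  shows "finite D" "card D \<le> (2 * (a + R + L) / L) ^ CARD('n)"
proof -
  let ?W = "centred_cube (a + R + L) :: (real ^ 'n) set"
  have mW: "measure lebesgue ?W = (2 * (a + R + L)) ^ CARD('n)"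
    using measure_cbox_cube[of "- (a + R + L)" "a + R + L", where 'n = 'n] assms
    by (simp add: centred_cube_def algebra_simps)
  have bound: "card E \<le> (2 * (a + R + L) / L) ^ CARD('n)" if E: "E \<subseteq> D" "finite E" for E
  proof -
    have "card ((+) c ` E) * measure lebesgue (cell L :: (real ^ 'n) set) \<le> measure lebesgue ?W"
    proof (rule card_disjoint_translates_le[OF cell_lmeasurable])
      show "?W \<in> lmeasurable"
        by (simp add: centred_cube_def)
      show "finite ((+) c ` E)"
        using E by simp
      fix p assume "p \<in> (+) c ` E"
      then obtain l where l: "p = c + l" "l \<in> D"
        using E by blast
      then obtain k where k: "k \<in> K" "p + k \<in> centred_cube a"
        by (auto simp: D_def translated_copy_eq)
      show "(+) p ` cell L \<subseteq> ?W"
      proof (rule image_subsetI)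
        fix z :: "real ^ 'n" assume "z \<in> cell L"
        have "- (a + R + L) \<le> (p + z) $ i \<and> (p + z) $ i \<le> a + R + L" for i
        proof -
          have "- a \<le> p $ i + k $ i" "p $ i + k $ i \<le> a"
            using k(2) by (simp_all add: centred_cube_def mem_box_cart)
          moreover have "\<bar>k $ i\<bar> \<le> R"
            using component_le_norm_cart[of k i] K[OF k(1)] by linarith
          moreover have "0 \<le> z $ i" "z $ i < L"
            using \<open>z \<in> cell L\<close> by (simp_all add: cell_def)
          ultimately show ?thesis
            unfolding vector_add_component by linarith
        qed
        then show "p + z \<in> ?W"
          unfolding centred_cube_def mem_box_cart by simp
      qed
    next
      fix p q assume "p \<in> (+) c ` E" "q \<in> (+) c ` E" "p \<noteq> q"
      then obtain l m where lm: "p = c + l" "q = c + m" "l \<in> cubic_lattice L" "m \<in> cubic_lattice L" "l \<noteq> m"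
        using E by (auto simp: D_def)
      show "disjnt ((+) p ` cell L) ((+) q ` cell L)"
        unfolding disjnt_iff
      proof (intro allI notI)
        fix w assume "w \<in> (+) p ` cell L \<and> w \<in> (+) q ` cell L"
        then obtain y z where yz: "y \<in> cell L" "z \<in> cell L" "w = c + l + y" "w = c + m + z"
          using lm by blast
        have "(w - c) - l = y"
          using yz(3) by simp
        moreover have "(w - c) - m = z"
          using yz(4) by simp
        ultimately have "(w - c) - l \<in> cell L" "(w - c) - m \<in> cell L"
          using yz(1,2) by blast+
        then have "l = m"
          by (rule cell_reduction_unique[OF lm(3,4)])
        then show False
          using lm(5) by simp
      qed
    qed
    moreover have "card ((+) c ` E) = card E"
      by (intro card_image) (simp add: inj_on_def)
    ultimately show ?thesis
      using measure_cell[OF \<open>0 < L\<close>, where 'n = 'n] mW \<open>0 < L\<close>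
      by (simp add: power_divide pos_le_divide_eq)
  qed
  show "finite D"
  proof (rule finite_if_finite_subsets_card_bdd[THEN conjunct1])
    fix E assume "E \<subseteq> D" "finite E"
    then show "card E \<le> nat \<lfloor>(2 * (a + R + L) / L) ^ CARD('n)\<rfloor>"
      using bound by (intro le_nat_floor) auto
  qed
  then show "card D \<le> (2 * (a + R + L) / L) ^ CARD('n)"
    using bound by blast
qed

text \<open>Counting translates that meet a cube of half-side \<open>a\<close> costs a factor \<open>(1 + (R + L) / a) ^ n\<close> against
  the number per cell, and this factor tends to one.\<close>

lemma periodic_covering_density_le:
  fixes K :: "(real ^ 'n) set"
  assumes K: "\<And>x. x \<in> K \<Longrightarrow> norm x \<le> R" and "K \<in> lmeasurable" "0 < L" "0 \<le> R"
    and C: "finite C"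
    and inj: "inj_on x I" and per: "x ` I \<subseteq> {c + l | c l. c \<in> C \<and> l \<in> cubic_lattice L}"
  shows "covering_density K I x \<le> ennreal (card C * measure lebesgue K / L ^ CARD('n))"
proof -
  let ?V = "measure lebesgue K"
  define J where "J a = {i \<in> I. translated_copy K (x i) \<inter> centred_cube a \<noteq> {}}" for a
  define g where "g a = card C * ?V / L ^ CARD('n) * (1 + (R + L) / a) ^ CARD('n)" for a :: real
  have count: "finite (J a)" "card (J a) \<le> card C * (2 * (a + R + L) / L) ^ CARD('n)" if "0 < a" for a
  proof -
    define D where "D c = {l \<in> cubic_lattice L. translated_copy K (c + l) \<inter> centred_cube a \<noteq> {}}" for c
    have D: "finite (D c)" "card (D c) \<le> (2 * (a + R + L) / L) ^ CARD('n)" for c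
      using translates_meeting_cube_bound[OF K \<open>0 < L\<close> \<open>0 \<le> R\<close>, where a = a and c = c] \<open>0 < a\<close>
      by (simp_all add: D_def)
    have sub: "x ` J a \<subseteq> (\<Union>c\<in>C. (+) c ` D c)"
    proof
      fix u assume "u \<in> x ` J a"
      then obtain i where i: "i \<in> I" "u = x i" "translated_copy K (x i) \<inter> centred_cube a \<noteq> {}"
        by (auto simp: J_def)
      then obtain c l where "c \<in> C" "l \<in> cubic_lattice L" "x i = c + l"
        using per by blast
      then show "u \<in> (\<Union>c\<in>C. (+) c ` D c)"
        using i by (auto simp: D_def)
    qed
    have fin: "finite (\<Union>c\<in>C. (+) c ` D c)"
      using C D(1) by blast
    have inj': "inj_on x (J a)"
      using inj by (rule inj_on_subset) (auto simp: J_def)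
    show "finite (J a)"
      using finite_subset[OF sub fin] inj' by (simp add: finite_image_iff)
    have "card (J a) = card (x ` J a)"
      using inj' by (simp add: card_image)
    also have "\<dots> \<le> card (\<Union>c\<in>C. (+) c ` D c)"
      by (rule card_mono[OF fin sub])
    also have "\<dots> \<le> (\<Sum>c\<in>C. card ((+) c ` D c))"
      by (rule card_UN_le[OF C])
    also have "\<dots> = (\<Sum>c\<in>C. card (D c))"
      by (simp add: card_image)
    finally have "real (card (J a)) \<le> (\<Sum>c\<in>C. real (card (D c)))"
      by (metis of_nat_le_iff of_nat_sum)
    also have "\<dots> \<le> card C * (2 * (a + R + L) / L) ^ CARD('n)"
      using D(2) by (intro sum_bounded_above) auto
    finally show "card (J a) \<le> card C * (2 * (a + R + L) / L) ^ CARD('n)" .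
  qed
  have le: "(\<Sum>\<^sub>\<infinity>i\<in>J a. emeasure lebesgue (translated_copy K (x i)))
      / emeasure lebesgue (centred_cube a :: (real ^ 'n) set) \<le> ennreal (g a)" if "0 < a" for a
  proof -
    have cube: "emeasure lebesgue (centred_cube a :: (real ^ 'n) set) = ennreal ((2 * a) ^ CARD('n))"
    proof -
      have "measure lebesgue (centred_cube a :: (real ^ 'n) set) = (2 * a) ^ CARD('n)"
        using measure_cbox_cube[of "- a" a, where 'n = 'n] \<open>0 < a\<close> by (simp add: centred_cube_def)
      moreover have "(centred_cube a :: (real ^ 'n) set) \<in> lmeasurable"
        by (simp add: centred_cube_def)
      ultimately show ?thesis
        by (metis emeasure_eq_measure2)
    qed
    have eK: "emeasure lebesgue (translated_copy K (x i)) = ennreal ?V" for i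
      using emeasure_eq_measure2[OF \<open>K \<in> lmeasurable\<close>]
      by (simp add: translated_copy_eq emeasure_lebesgue_translation)
    have "(\<Sum>\<^sub>\<infinity>i\<in>J a. emeasure lebesgue (translated_copy K (x i))) = ennreal (card (J a) * ?V)"
      using count(1)[OF that] by (simp add: eK ennreal_mult' ennreal_of_nat_eq_real_of_nat)
    then have "(\<Sum>\<^sub>\<infinity>i\<in>J a. emeasure lebesgue (translated_copy K (x i)))
        / emeasure lebesgue (centred_cube a :: (real ^ 'n) set) = ennreal (card (J a) * ?V / (2 * a) ^ CARD('n))"
      using \<open>0 < a\<close> by (simp add: cube divide_ennreal)
    also have "\<dots> \<le> ennreal (g a)"
    proof (rule ennreal_leI)
      have "card (J a) * ?V / (2 * a) ^ CARD('n)
          \<le> (card C * (2 * (a + R + L) / L) ^ CARD('n)) * ?V / (2 * a) ^ CARD('n)"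
        using count(2)[OF that] \<open>0 < a\<close> by (intro divide_right_mono mult_right_mono) auto
      also have "\<dots> = card C * ?V * ((2 * (a + R + L) / L) / (2 * a)) ^ CARD('n)"
        unfolding power_divide[of "2 * (a + R + L) / L" "2 * a"] by (simp only: times_divide_eq_right mult_ac)
      also have "(2 * (a + R + L) / L) / (2 * a) = (1 / L) * (1 + (R + L) / a)"
        using \<open>0 < a\<close> \<open>0 < L\<close> by (simp add: field_simps)
      also have "card C * ?V * ((1 / L) * (1 + (R + L) / a)) ^ CARD('n) = g a"
        by (simp add: g_def power_mult_distrib power_inverse divide_inverse)
      finally show "card (J a) * ?V / (2 * a) ^ CARD('n) \<le> g a" .
    qed
    finally show ?thesis .
  qed
  have "((\<lambda>a. (R + L) / a) \<longlongrightarrow> 0) at_top"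
    by (rule real_tendsto_divide_at_top[OF tendsto_const filterlim_ident])
  then have "(g \<longlongrightarrow> card C * ?V / L ^ CARD('n) * (1 + 0) ^ CARD('n)) at_top"
    unfolding g_def by (intro tendsto_intros)
  then have "((\<lambda>a. ennreal (g a)) \<longlongrightarrow> ennreal (card C * ?V / L ^ CARD('n))) at_top"
    by (intro tendsto_ennrealI) simp
  then have lim: "Limsup at_top (\<lambda>a. ennreal (g a)) = ennreal (card C * ?V / L ^ CARD('n))"
    by (intro lim_imp_Limsup) simp
  have "covering_density K I x \<le> Limsup at_top (\<lambda>a. ennreal (g a))"
    unfolding covering_density_def J_def[symmetric]
    by (intro Limsup_mono eventually_mono[OF eventually_gt_at_top[of 0] le])
  then show ?thesis
    unfolding lim .
qed

theorem theorem1p3: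
  fixes K :: "(real ^ 'n) set"
  assumes "bounded K"
    and "K \<in> sets lebesgue"
    and "\<exists>\<delta>>0. measure lebesgue (inner_parallel_body \<delta> K) > 0"
  shows "\<exists>(I :: nat set) (x :: nat \<Rightarrow> real ^ 'n).
           is_translative_covering K I x \<and>
           enn2ereal (covering_density K I x) \<le>
             (INF \<delta>\<in>{\<delta>. \<delta> > 0 \<and> measure lebesgue (inner_parallel_body \<delta> K) > 0}.
                ereal (measure lebesgue K / measure lebesgue (inner_parallel_body \<delta> K) *
                  (1 + ln (measure lebesgue (inner_parallel_body (\<delta> / 2) K) /
                           measure lebesgue (cball (0 :: real ^ 'n) (\<delta> / 2))))))"
proof -
  obtain R where R: "0 < R" "\<And>x. x \<in> K \<Longrightarrow> norm x \<le> R"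
    using \<open>bounded K\<close> unfolding bounded_pos by blast
  \<comment> \<open>One period for all \<open>\<delta>\<close>, large enough for \<open>K\<close> to embed into the torus.\<close>
  define L where "L = 2 * R + 1"
  have L: "0 < L" "2 * R < L"
    using R(1) by (auto simp: L_def)
  have Km: "K \<in> lmeasurable"
    using assms(1,2) by (rule bounded_set_imp_lmeasurable)
  define bnd where "bnd \<delta> = 1 / measure lebesgue (inner_parallel_body \<delta> K) *
      (1 + ln (measure lebesgue (inner_parallel_body (\<delta> / 2) K) /
               measure lebesgue (cball (0 :: real ^ 'n) (\<delta> / 2))))" for \<delta>
  have ex: "\<exists>C. finite C \<and> covers_torus L K C \<and> card C \<le> L ^ CARD('n) * bnd \<delta>"
    if "0 < \<delta>" "0 < measure lebesgue (inner_parallel_body \<delta> K)" for \<delta>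
    using torus_covering_exists[OF R(2) L that] by (simp add: bnd_def)
  then obtain C0 where "finite C0 \<and> covers_torus L K C0"
    using assms(3) by blast
  \<comment> \<open>A smallest covering of the torus is at least as good as the one obtained from any \<open>\<delta>\<close>, so it
    meets the infimum even where no \<open>\<delta>\<close> attains it.\<close>
  then obtain C where C: "finite C" "covers_torus L K C"
    and min: "\<And>C'. finite C' \<Longrightarrow> covers_torus L K C' \<Longrightarrow> card C \<le> card C'"
    using ex_has_least_nat[of "\<lambda>C. finite C \<and> covers_torus L K C" C0 card] by blast
  \<comment> \<open>Enumerating the set of translation vectors removes repetitions, which could otherwise
    be counted several times in the density.\<close>
  define X where "X = {c + l | c l. c \<in> C \<and> l \<in> cubic_lattice L}"
  have X_eq: "X = (\<lambda>(c, l). c + l) ` (C \<times> cubic_lattice L)"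
    by (auto simp: X_def)
  have "countable X"
    unfolding X_eq by (intro countable_image countable_SIGMA countable_finite[OF C(1)] countable_cubic_lattice)
  define I where "I = to_nat_on X ` X"
  define x where "x = from_nat_into X"
  have xI: "x ` I = X"
    using \<open>countable X\<close> by (force simp: I_def x_def image_image)
  have inj: "inj_on x I"
    using \<open>countable X\<close> by (auto simp: inj_on_def I_def x_def)
  have "is_translative_covering K I x"
    unfolding is_translative_covering_def
  proof (rule UNIV_eq_I[symmetric])
    fix y :: "real ^ 'n"
    obtain c l where cl: "c \<in> C" "l \<in> cubic_lattice L" "y - (c + l) \<in> K"
      using C(2) unfolding covers_torus_def by blast
    then have "c + l \<in> x ` I"
      unfolding xI X_def by blast
    then obtain i where "i \<in> I" "x i = c + l"
      by auto
    moreover have "y \<in> translated_copy K (c + l)"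
      unfolding translated_copy_def using cl(3) by (intro image_eqI[of _ _ "y - (c + l)"]) simp_all
    ultimately show "y \<in> (\<Union>i\<in>I. translated_copy K (x i))"
      by (metis UN_I)
  qed
  moreover have "enn2ereal (covering_density K I x) \<le>
      ereal (measure lebesgue K / measure lebesgue (inner_parallel_body \<delta> K) *
        (1 + ln (measure lebesgue (inner_parallel_body (\<delta> / 2) K) /
                 measure lebesgue (cball (0 :: real ^ 'n) (\<delta> / 2)))))"
    if \<delta>: "0 < \<delta>" "0 < measure lebesgue (inner_parallel_body \<delta> K)" for \<delta>
  proof -
    obtain C' where C': "finite C'" "covers_torus L K C'" "card C' \<le> L ^ CARD('n) * bnd \<delta>"
      using ex[OF \<delta>] by blast
    have "real (card C) \<le> card C'"
      using min[OF C'(1,2)] by simp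
    also have "\<dots> \<le> L ^ CARD('n) * bnd \<delta>"
      by (rule C'(3))
    finally have "card C / L ^ CARD('n) \<le> bnd \<delta>"
      using L(1) by (simp add: pos_divide_le_eq mult.commute)
    then have num: "card C * measure lebesgue K / L ^ CARD('n) \<le> measure lebesgue K * bnd \<delta>"
      using mult_right_mono[of "card C / L ^ CARD('n)" "bnd \<delta>" "measure lebesgue K"] by (simp add: mult.commute)
    have "covering_density K I x \<le> ennreal (card C * measure lebesgue K / L ^ CARD('n))"
      using R L C xI inj Km by (intro periodic_covering_density_le) (auto simp: X_def)
    then have "enn2ereal (covering_density K I x) \<le> ereal (card C * measure lebesgue K / L ^ CARD('n))"
      using L(1) by (simp add: less_eq_ennreal.rep_eq enn2ereal_ennreal)
    also have "\<dots> \<le> ereal (measure lebesgue K * bnd \<delta>)"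
      using num by simp
    finally show ?thesis
      by (simp add: bnd_def)
  qed
  then have "enn2ereal (covering_density K I x) \<le>
      (INF \<delta>\<in>{\<delta>. \<delta> > 0 \<and> measure lebesgue (inner_parallel_body \<delta> K) > 0}.
        ereal (measure lebesgue K / measure lebesgue (inner_parallel_body \<delta> K) *
          (1 + ln (measure lebesgue (inner_parallel_body (\<delta> / 2) K) /
                   measure lebesgue (cball (0 :: real ^ 'n) (\<delta> / 2))))))"
    by (intro INF_greatest) auto
  ultimately show ?thesis
    by blast
qed

end
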